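(* For real $\nu>-1$ let $\phi_\nu(z)=2^{\nu}\Gamma(\nu+1)z^{1-\frac{\nu}{2}}J_\nu(\sqrt z)$, where $J_\nu$ is the Bessel function of the first kind of order $\nu$, and let $r^\star(\phi_\nu)$ be its radius of starlikeness. Then, as $\nu\to+\infty$ through real values, $r^\star(\phi_\nu)$ has the asymptotic expansion \[ r^\star(\phi_\nu)\sim 4\nu\left(1+\sum_{k=1}^\infty\frac{\varepsilon_k}{\nu^k}\right)=4\nu\left(1+\frac{1}{\nu^2}-\frac{4}{\nu^4}+\frac{2}{\nu^5}+\frac{44}{\nu^6}-\cdots\right), \] where the coefficients $\varepsilon_k$ ($k\ge 1$) are determined recursively by \[ \varepsilon_k=(-1)^{k+1}-\sum_{n=1}^{k-1}(-1)^{k-n}\varepsilon_n-\sum_{n=2}^{k+1}4^n\sum_{m=0}^{k-n+1}\sigma^{(n)}_{k-n-m+1}\,\mathsf{A}_{n,m}(\varepsilon_1,\varepsilon_2,\ldots,\varepsilon_m). \] (In particular $\varepsilon_1=0$, $\varepsilon_2=1$, $\varepsilon_3=0$, $\varepsilon_4=-4$, $\varepsilon_5=2$, $\varepsilon_6=44$.)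
   Context: The function $\phi_\nu$ is understood as the entire function $\phi_\nu(z)=z\sum_{j\ge0}\frac{(-1)^j (z/4)^j}{j!\,(\nu+1)_j}$ with $(a)_j=a(a+1)\cdots(a+j-1)$; it satisfies $\phi_\nu(0)=0$, $\phi_\nu'(0)=1$. For a function $f$ with $f(0)=0$, $f'(0)=1$, the radius of starlikeness is \[ r^{\star}(f)=\sup\left\{r>0:\ \Re\left(\frac{zf'(z)}{f(z)}\right)>0\ \text{for all } z\in\mathbb{D}_r\right\},\qquad \mathbb{D}_r=\{z\in\mathbb{C}:|z|<r\}, \] where $zf'(z)/f(z)$ is given its limiting value $1$ at $z=0$ (and the condition requires the quotient to be finite on $\mathbb{D}_r$). The numbers $\sigma_m^{(k)}$ ($k\ge1$, $m\ge0$) are defined by \[ \sigma_m^{(1)}=\frac{(-1)^m}{4},\qquad \sigma_m^{(k)}=\sum_{i=0}^m\sum_{j=0}^i\sum_{n=1}^{k-1}(-k)^{m-i}\sigma_j^{(n)}\sigma_{i-j}^{(k-n)}\quad(k\ge2). \] The ordinary potential polynomials $\mathsf{A}_{\mu,n}$ ($\mu\in\mathbb{C}$, $n\ge0$) are defined by the generating function (formal power series in $z$) \[ \left(1+\sum_{n=1}^\infty x_nz^n\right)^\mu=\sum_{n=0}^\infty\mathsf{A}_{\mu,n}(x_1,x_2,\ldots,x_n)z^n , \] so $\mathsf{A}_{\mu,0}=1$, $\mathsf{A}_{\mu,1}=\mu x_1$, $\mathsf{A}_{\mu,2}=\mu x_2+\binom{\mu}{2}x_1^2$. Empty sums are zero.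 The asymptotic expansion is in the Poincaré sense: for every $N\ge1$, $\frac{r^\star(\phi_\nu)}{4\nu}=1+\sum_{k=1}^{N-1}\varepsilon_k\nu^{-k}+\mathcal{O}_N(\nu^{-N})$ as $\nu\to+\infty$. *)

theory Defs
  imports
    "HOL-Complex_Analysis.Complex_Analysis"
    "HOL-Library.Landau_Symbols"
begin

section \<open>Bessel functions and their normalization\<close>

text \<open>
  Bessel function of the first kind, principal branch, for \<open>w \<noteq> 0\<close>. (At \<open>w = 0\<close> the convention
  \<open>0 powr \<nu> = 0\<close> would give the wrong value for \<open>\<nu> = 0\<close>.)
\<close>
definition bessel_J :: "complex \<Rightarrow> complex \<Rightarrow> complex" where
  "bessel_J \<nu> w = (w / 2) powr \<nu> *
     (\<Sum>j. (-1) ^ j * rGamma (\<nu> + of_nat j + 1) / fact j * (w / 2) ^ (2 * j))"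

text \<open>
  The function \<open>2\<^sup>\<nu> \<Gamma>(\<nu> + 1) z\<^sup>1\<^sup>-\<^sup>\<nu>\<^sup>/\<^sup>2 J\<^sub>\<nu>(\<surd>z)\<close>, understood as the entire function given by its
  power series; see \<open>bessel_phi_eq\<close> below.
\<close>
definition bessel_phi :: "real \<Rightarrow> complex \<Rightarrow> complex" where
  "bessel_phi \<nu> z =
     z * (\<Sum>j. (-1) ^ j * (z / 4) ^ j / (fact j * pochhammer (of_real \<nu> + 1) j))"

lemma summable_bessel_phi:
  fixes \<nu> :: real and z :: complex
  assumes "\<nu> > -1"
  shows "summable (\<lambda>j. (-1) ^ j * (z / 4) ^ j / (fact j * pochhammer (complex_of_real \<nu> + 1) j))"
proof -
  define b where "b = min 1 (\<nu> + 1)"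
  have b: "b > 0" "b \<le> 1" "b \<le> \<nu> + 1"
    using assms by (auto simp: b_def)
  have poch: "norm (pochhammer (complex_of_real \<nu> + 1) j) \<ge> b" for j
  proof -
    have "pochhammer (\<nu> + 1) j \<ge> b"
    proof (cases j)
      case 0
      then show ?thesis using b by simp
    next
      case (Suc i)
      have "pochhammer (\<nu> + 1 + 1) i \<ge> 1"
        unfolding pochhammer_prod using assms by (intro prod_ge_1) auto
      then have "(\<nu> + 1) * 1 \<le> (\<nu> + 1) * pochhammer (\<nu> + 1 + 1) i"
        using assms by (intro mult_left_mono) auto
      then show ?thesis using b(3) unfolding Suc pochhammer_rec mult_1_right by (rule order_trans[rotated])
    qed
    moreover have "pochhammer (complex_of_real \<nu> + 1) j = complex_of_real (pochhammer (\<nu> + 1) j)"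
      using pochhammer_of_real[of "\<nu> + 1" j, where 'a = complex] by simp
    ultimately show ?thesis using b by (simp add: abs_if)
  qed
  have "summable (\<lambda>j. inverse b * (inverse (fact j) * norm (z / 4) ^ j))"
    by (intro summable_mult summable_exp)
  then show ?thesis
  proof (rule summable_comparison_test'[where N = 0])
    fix j :: nat
    have "norm (z / 4) ^ j / (fact j * norm (pochhammer (complex_of_real \<nu> + 1) j))
        \<le> norm (z / 4) ^ j / (fact j * b)"
      using b poch[of j] by (intro divide_left_mono mult_left_mono mult_pos_pos) auto
    then show "norm ((-1) ^ j * (z / 4) ^ j / (fact j * pochhammer (complex_of_real \<nu> + 1) j))
        \<le> inverse b * (inverse (fact j) * norm (z / 4) ^ j)"
      by (simp add: norm_mult norm_divide norm_power field_simps)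
  qed
qed

lemma bessel_phi_eq:
  assumes "\<nu> > -1" "z \<noteq> 0"
  shows "bessel_phi \<nu> z =
    2 powr (of_real \<nu>) * Gamma (of_real \<nu> + 1) * z powr (1 - of_real \<nu> / 2) *
    bessel_J (of_real \<nu>) (csqrt z)"
proof -
  let ?\<nu> = "complex_of_real \<nu>"
  let ?S = "\<lambda>j. (-1) ^ j * (z / 4) ^ j / (fact j * pochhammer (?\<nu> + 1) j)"
  have nonpole: "?\<nu> + 1 \<notin> \<int>\<^sub>\<le>\<^sub>0"
  proof
    assume "?\<nu> + 1 \<in> \<int>\<^sub>\<le>\<^sub>0"
    then obtain n where n: "?\<nu> + 1 = of_int n" "n \<le> 0" by (elim nonpos_Ints_cases)
    then have "Re (?\<nu> + 1) \<le> 0" by simp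
    then show False using assms by simp
  qed
  have G0: "Gamma (?\<nu> + 1) \<noteq> 0"
    using nonpole by (simp add: Gamma_eq_zero_iff)
  have term_eq: "(-1) ^ j * rGamma (?\<nu> + of_nat j + 1) / fact j * (csqrt z / 2) ^ (2 * j)
      = rGamma (?\<nu> + 1) * ?S j" for j
  proof -
    have p0: "pochhammer (?\<nu> + 1) j \<noteq> 0"
      using nonpole by (metis pochhammer_eq_0_imp_nonpos_Int)
    have "rGamma (?\<nu> + 1) = pochhammer (?\<nu> + 1) j * rGamma (?\<nu> + 1 + of_nat j)"
      by (rule pochhammer_rGamma)
    then have "rGamma (?\<nu> + of_nat j + 1) = rGamma (?\<nu> + 1) / pochhammer (?\<nu> + 1) j"
      using p0 by (simp add: field_simps)
    moreover have "(csqrt z / 2) ^ (2 * j) = (z / 4) ^ j"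
      by (simp add: power_mult power_divide)
    ultimately show ?thesis by (simp add: mult_ac)
  qed
  have J: "bessel_J ?\<nu> (csqrt z) = (csqrt z / 2) powr ?\<nu> * (rGamma (?\<nu> + 1) * (\<Sum>j. ?S j))"
    unfolding bessel_J_def term_eq
    using suminf_mult[OF summable_bessel_phi[OF assms(1), of z]] by simp
  have "Ln (csqrt z) = Ln z / 2"
  proof (rule Ln_unique)
    show "exp (Ln z / 2) = csqrt z" using assms(2) by (simp add: csqrt_exp_Ln)
    show "- pi < Im (Ln z / 2)" "Im (Ln z / 2) \<le> pi"
      using mpi_less_Im_Ln[OF assms(2)] Im_Ln_le_pi[OF assms(2)] pi_gt_zero by simp_all
  qed
  moreover have "Ln (csqrt z / 2) = Ln (csqrt z) - of_real (ln 2)"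
    using Ln_divide_of_real[of 2 "csqrt z"] assms(2) by simp
  moreover have "Ln (2 :: complex) = of_real (ln 2)"
    using Ln_of_real[of 2] by simp
  ultimately have "Ln (csqrt z / 2) = Ln z / 2 - Ln 2"
    by simp
  then have "2 powr ?\<nu> * z powr (1 - ?\<nu> / 2) * (csqrt z / 2) powr ?\<nu> =
      exp (?\<nu> * Ln 2 + (1 - ?\<nu> / 2) * Ln z + ?\<nu> * (Ln z / 2 - Ln 2))"
    using assms(2) by (simp only: powr_def exp_add) simp
  also have "?\<nu> * Ln 2 + (1 - ?\<nu> / 2) * Ln z + ?\<nu> * (Ln z / 2 - Ln 2) = Ln z"
    by (simp add: algebra_simps)
  finally have "2 powr ?\<nu> * z powr (1 - ?\<nu> / 2) * (csqrt z / 2) powr ?\<nu> = exp (Ln z)" .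
  then have "2 powr ?\<nu> * z powr (1 - ?\<nu> / 2) * (csqrt z / 2) powr ?\<nu> = z"
    using assms(2) by simp
  moreover have "Gamma (?\<nu> + 1) * rGamma (?\<nu> + 1) = 1"
    using G0 by (simp add: rGamma_inverse_Gamma)
  ultimately have "z * (\<Sum>j. ?S j) = (2 powr ?\<nu> * z powr (1 - ?\<nu> / 2) * (csqrt z / 2) powr ?\<nu>)
      * (Gamma (?\<nu> + 1) * rGamma (?\<nu> + 1)) * (\<Sum>j. ?S j)"
    by simp
  then show ?thesis
    unfolding bessel_phi_def J by (simp add: mult_ac)
qed

section \<open>Radius of starlikeness\<close>

text \<open>
  Intended for \<open>f\<close> with \<open>f 0 = 0\<close> and \<open>deriv f 0 = 1\<close>, for which the quotient has limit 1 at the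
  origin, so that the condition at \<open>0\<close> holds and is left out. The condition \<open>f z \<noteq> 0\<close> says that
  the quotient is finite.
\<close>
definition radius_of_starlikeness :: "(complex \<Rightarrow> complex) \<Rightarrow> real" where
  "radius_of_starlikeness f =
     Sup {r. r > 0 \<and> (\<forall>z \<in> ball 0 r. z \<noteq> 0 \<longrightarrow> f z \<noteq> 0 \<and> Re (z * deriv f z / f z) > 0)}"

section \<open>Coefficients of the expansion\<close>

text \<open>\<open>sigma_coeff k m\<close> is \<open>\<sigma>\<^sub>m\<close> with upper index \<open>k \<ge> 1\<close>; the value at \<open>k = 0\<close> is irrelevant.\<close>
function sigma_coeff :: "nat \<Rightarrow> nat \<Rightarrow> real" where
  "sigma_coeff k m =
     (if k = 1 then (-1) ^ m / 4
      else (\<Sum>i=0..m. \<Sum>j=0..i. \<Sum>n=1..k-1. (- real k) ^ (m - i) * sigma_coeff n j * sigma_coeff (k - n) (i - j)))"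
  by auto
termination
  by (relation "Wellfounded.measure fst") auto

declare sigma_coeff.simps [simp del]

text \<open>
  Ordinary potential polynomials: \<open>fps_binomial \<mu>\<close> is \<open>(1 + X)\<^sup>\<mu>\<close>. The entry \<open>x 0\<close> of the
  argument sequence is not used.
\<close>
definition potential_poly :: "'a::field_char_0 \<Rightarrow> nat \<Rightarrow> (nat \<Rightarrow> 'a) \<Rightarrow> 'a" where
  "potential_poly \<mu> n x =
     fps_nth (fps_binomial \<mu> oo Abs_fps (\<lambda>i. if i = 0 then 0 else x i)) n"

lemma potential_poly_of_nat:
  "potential_poly (of_nat k) n x = fps_nth (Abs_fps (\<lambda>i. if i = 0 then 1 else x i) ^ k) n"
proof -
  let ?X = "Abs_fps (\<lambda>i. if i = 0 then 0 else x i)"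
  have "fps_binomial (of_nat k) oo ?X = ((1 + fps_X) oo ?X) ^ k"
    by (simp add: fps_binomial_of_nat fps_compose_power)
  also have "(1 + fps_X) oo ?X = Abs_fps (\<lambda>i. if i = 0 then 1 else x i)"
    by (simp add: fps_compose_add_distrib fps_eq_iff)
  finally show ?thesis by (simp add: potential_poly_def)
qed

lemma potential_poly_0: "potential_poly \<mu> 0 x = 1"
  by (simp add: potential_poly_def)

lemma fps_power_nth_cong:
  fixes f g :: "'a::comm_ring_1 fps"
  assumes "\<And>i. i \<le> n \<Longrightarrow> fps_nth f i = fps_nth g i" "j \<le> n"
  shows "fps_nth (f ^ k) j = fps_nth (g ^ k) j"
  using assms(2)
proof (induction k arbitrary: j)
  case (Suc k)
  then show ?case using assms(1) by (auto simp: fps_mult_nth intro!: sum.cong)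
qed simp

lemma potential_poly_cong [fundef_cong]:
  assumes "\<mu> = \<mu>'" "n = n'" "\<And>i. 1 \<le> i \<Longrightarrow> i \<le> n' \<Longrightarrow> x i = x' i"
  shows "potential_poly \<mu> n x = potential_poly \<mu>' n' x'"
  unfolding potential_poly_def fps_compose_nth assms(1,2)
  by (intro sum.cong refl arg_cong2[where f = "(*)"] fps_power_nth_cong[where n = n'])
     (use assms(3) in auto)

text \<open>
  Only \<open>k \<ge> 1\<close> is meant. The limit \<open>k - n + 1\<close> and the index \<open>k - n - m + 1\<close> are written
  \<open>k + 1 - n\<close> and \<open>k + 1 - n - m\<close>, so that no subtraction is truncated when \<open>n = k + 1\<close>.
\<close>
function eps_coeff :: "nat \<Rightarrow> real" where
  "eps_coeff k =
     (-1) ^ (k + 1) - (\<Sum>n=1..k-1. (-1) ^ (k - n) * eps_coeff n)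
     - (\<Sum>n=2..k+1. 4 ^ n *
         (\<Sum>m=0..k+1-n. sigma_coeff n (k + 1 - n - m) * potential_poly (real n) m eps_coeff))"
  by auto
termination
  by (relation "Wellfounded.measure id") auto

declare eps_coeff.simps [simp del]

end

theory Submission
  imports Defs
begin

text \<open>
  Write \<open>\<phi> z = z \<psi> z\<close> for \<open>\<phi> = bessel_phi \<nu>\<close>, and \<open>F z = - z \<psi>' z / \<psi> z\<close>, so that
  \<open>z \<phi>' z / \<phi> z = 1 - F z\<close>. The differential equation of \<open>\<psi>\<close> becomes the Riccati equation
  \<open>z F' + \<nu> F = z / 4 + F\<^sup>2\<close>, that is, the recurrence
  \<open>(k + \<nu>) s\<^sub>k = [k = 1] / 4 + \<Sum>n. s\<^sub>n s\<^sub>k\<^sub>-\<^sub>n\<close> for the coefficients \<open>s\<^sub>k\<close> of \<open>F\<close>. (The \<open>s\<^sub>k\<close> are the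
  Rayleigh sums, the sums of the \<open>k\<close>-th powers of the reciprocals of the zeros of \<open>\<psi>\<close>.) Two things follow from the recurrence alone. First, \<open>s\<^sub>k \<ge> 0\<close>, hence
  \<open>Re (F z) \<le> F \<bar>z\<bar>\<close> with equality on the positive axis, and the radius of starlikeness is the positive
  root of \<open>F r = 1\<close>. Second, \<open>s\<^sub>k = t\<^sub>k / \<nu>\<^sup>2\<^sup>k\<^sup>-\<^sup>1\<close>, where \<open>t\<^sub>k\<close> is a rational function of \<open>h = 1 / \<nu>\<close> that is
  regular at \<open>h = 0\<close> and whose Taylor coefficients there are the numbers \<open>sigma_coeff k\<close>; moreover
  \<open>\<Sum>k. t\<^sub>k \<le> 1 / 2\<close> uniformly in \<open>h \<ge> 0\<close>.

  In the scaled variable \<open>y = r h\<^sup>2\<close> the equation for the radius is \<open>S y = h\<close> with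
  \<open>S y = \<Sum>k. t\<^sub>k y\<^sup>k\<close>. Since \<open>y \<approx> 4 h\<close>, the terms beyond \<open>k = N\<close> contribute \<open>O(h\<^sup>N\<^sup>+\<^sup>1)\<close>. The recursion of
  \<open>eps_coeff\<close> says exactly that \<open>y = 4 h (1 + \<Sum>k. \<epsilon>\<^sub>k h\<^sup>k)\<close> solves the equation formally, so a
  truncation of this series solves it up to \<open>O(h\<^sup>N\<^sup>+\<^sup>1)\<close>. Because all \<open>t\<^sub>k\<close> are nonnegative, \<open>S\<close> increases
  at least as fast as its linear term \<open>y / (4 (1 + h))\<close>, and so a small defect in the equation means a
  small distance to the root (\<open>rayleigh_series_expanding\<close>). The pieces come together in
  \<open>radius_of_starlikeness_bessel_phi\<close>, \<open>truncated_equation_bigo\<close> and \<open>radius_expansion_at_zero\<close>.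
\<close>

section \<open>Rayleigh sums and their generating function\<close>

text \<open>
  The numbers \<open>t\<^sub>k\<close>: the \<open>k\<close>-th Rayleigh sum \<open>\<Sum>n. j\<^sub>\<nu>\<^sub>,\<^sub>n\<^sup>-\<^sup>2\<^sup>k\<close> times \<open>\<nu>\<^sup>2\<^sup>k\<^sup>-\<^sup>1\<close>, as a function of \<open>h = 1 / \<nu>\<close>.
  In terms of \<open>h\<close> rather than \<open>\<nu>\<close> the definition makes sense at \<open>h = 0\<close> and is a power series there.
\<close>
function scaled_rayleigh :: "real \<Rightarrow> nat \<Rightarrow> real" where
  "scaled_rayleigh h k =
     ((if k = 1 then 1 / 4 else 0) + (\<Sum>n=1..k-1. scaled_rayleigh h n * scaled_rayleigh h (k - n)))
     / (1 + real k * h)"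
  by auto
termination
  by (relation "Wellfounded.measure snd") auto

declare scaled_rayleigh.simps [simp del]

lemma scaled_rayleigh_0 [simp]: "scaled_rayleigh h 0 = 0"
  by (subst scaled_rayleigh.simps) simp

lemma scaled_rayleigh_1: "scaled_rayleigh h (Suc 0) = 1 / (4 * (1 + h))"
  by (subst scaled_rayleigh.simps) simp

lemma scaled_rayleigh_rec:
  assumes "h \<ge> 0"
  shows "(1 + real k * h) * scaled_rayleigh h k =
     (if k = 1 then 1 / 4 else 0) + (\<Sum>n=1..k-1. scaled_rayleigh h n * scaled_rayleigh h (k - n))"
proof -
  have "0 \<le> real k * h"
    using assms by simp
  then have "1 + real k * h \<noteq> 0"
    by linarith
  then show ?thesis
    by (subst scaled_rayleigh.simps[of h k]) simp
qed

lemma scaled_rayleigh_nonneg: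
  assumes "h \<ge> 0"
  shows "scaled_rayleigh h k \<ge> 0"
proof (induction k rule: less_induct)
  case (less k)
  have "(\<Sum>n=1..k-1. scaled_rayleigh h n * scaled_rayleigh h (k - n)) \<ge> 0"
    by (intro sum_nonneg mult_nonneg_nonneg less) auto
  then show ?case
    using assms by (subst scaled_rayleigh.simps) (intro divide_nonneg_nonneg add_nonneg_nonneg; simp)
qed

text \<open>
  The recurrence gives \<open>T\<^sub>K\<^sub>+\<^sub>1 \<le> 1 / 4 + T\<^sub>K\<^sup>2\<close> for the partial sums, and \<open>1 / 2\<close> is the fixed point of
  \<open>x \<mapsto> 1 / 4 + x\<^sup>2\<close>.
\<close>
lemma sum_scaled_rayleigh_le:
  assumes h: "h \<ge> 0"
  shows "(\<Sum>k\<le>K. scaled_rayleigh h k) \<le> 1 / 2"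
proof (induction K)
  case (Suc K)
  let ?t = "scaled_rayleigh h"
  note nonneg = scaled_rayleigh_nonneg[OF h]
  have "(\<Sum>k\<le>Suc K. ?t k) = (\<Sum>k\<in>{1..Suc K}. ?t k)"
    by (simp add: atMost_atLeast0 sum.atLeast_Suc_atMost)
  also have "\<dots> \<le> (\<Sum>k\<in>{1..Suc K}. (if k = 1 then 1 / 4 else 0) + (\<Sum>n=1..k-1. ?t n * ?t (k - n)))"
  proof (rule sum_mono)
    fix k
    have "1 * ?t k \<le> (1 + real k * h) * ?t k"
      using h nonneg by (intro mult_right_mono) auto
    then show "?t k \<le> (if k = 1 then 1 / 4 else 0) + (\<Sum>n=1..k-1. ?t n * ?t (k - n))"
      using scaled_rayleigh_rec[OF h, of k] by simp
  qed
  also have "\<dots> = 1 / 4 + (\<Sum>k\<in>{1..Suc K}. \<Sum>n=1..k-1. ?t n * ?t (k - n))"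
    by (subst sum.distrib) (simp add: sum.delta)
  \<comment> \<open>The pairs \<open>(n, k - n)\<close> are distinct and lie in the square \<open>{..K} \<times> {..K}\<close>.\<close>
  also have "(\<Sum>k\<in>{1..Suc K}. \<Sum>n=1..k-1. ?t n * ?t (k - n)) =
      (\<Sum>(k, n)\<in>(SIGMA k:{1..Suc K}. {1..k-1}). ?t n * ?t (k - n))"
    by (subst sum.Sigma) auto
  also have "\<dots> = (\<Sum>p\<in>(\<lambda>(k, n). (n, k - n)) ` (SIGMA k:{1..Suc K}. {1..k-1}). ?t (fst p) * ?t (snd p))"
    by (subst sum.reindex) (auto simp: inj_on_def case_prod_unfold)
  also have "\<dots> \<le> (\<Sum>p\<in>{..K} \<times> {..K}. ?t (fst p) * ?t (snd p))"
    by (intro sum_mono2) (auto intro!: mult_nonneg_nonneg nonneg)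
  also have "\<dots> = (\<Sum>k\<le>K. ?t k) * (\<Sum>k\<le>K. ?t k)"
    by (simp add: sum_product sum.cartesian_product case_prod_unfold)
  also have "\<dots> \<le> 1 / 2 * (1 / 2)"
    by (intro mult_mono Suc.IH sum_nonneg nonneg) auto
  finally show ?case by simp
qed simp

lemma summable_scaled_rayleigh:
  assumes "h \<ge> 0"
  shows "summable (scaled_rayleigh h)"
proof (rule summableI_nonneg_bounded)
  fix n
  show "(\<Sum>k<n. scaled_rayleigh h k) \<le> 1 / 2"
    using sum_scaled_rayleigh_le[OF assms, of "n - 1"]
    by (cases n) (auto simp: lessThan_Suc_atMost)
qed (rule scaled_rayleigh_nonneg[OF assms])

definition rayleigh_series :: "real \<Rightarrow> real \<Rightarrow> real" where
  "rayleigh_series h y = (\<Sum>k. scaled_rayleigh h k * y ^ k)"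

lemma summable_rayleigh_series:
  assumes "h \<ge> 0" "0 \<le> y" "y \<le> 1"
  shows "summable (\<lambda>k. scaled_rayleigh h k * y ^ k)"
proof (rule summable_comparison_test'[OF summable_scaled_rayleigh[OF assms(1)], where N = 0])
  fix k :: nat
  show "norm (scaled_rayleigh h k * y ^ k) \<le> scaled_rayleigh h k"
    using scaled_rayleigh_nonneg[OF assms(1), of k] power_le_one[OF assms(2,3), of k] assms(2)
    by (simp add: abs_mult mult_left_le)
qed

text \<open>
  With nonnegative coefficients every term of the difference is nonnegative, so the linear term alone
  is a lower bound. This is both strict monotonicity and the stability of the root.
\<close>
lemma rayleigh_series_expanding:
  assumes h: "h \<ge> 0" and "0 \<le> x" "x \<le> y" "y \<le> 1"
  shows "(y - x) / (4 * (1 + h)) \<le> rayleigh_series h y - rayleigh_series h x"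
proof -
  have sy: "summable (\<lambda>k. scaled_rayleigh h k * y ^ k)" and sx: "summable (\<lambda>k. scaled_rayleigh h k * x ^ k)"
    using assms by (auto intro!: summable_rayleigh_series)
  have "(y - x) / (4 * (1 + h)) = (\<Sum>k\<in>{1}. scaled_rayleigh h k * y ^ k - scaled_rayleigh h k * x ^ k)"
    by (simp add: scaled_rayleigh_1 diff_divide_distrib)
  also have "\<dots> \<le> (\<Sum>k. scaled_rayleigh h k * y ^ k - scaled_rayleigh h k * x ^ k)"
    using assms scaled_rayleigh_nonneg[OF h]
    by (intro sum_le_suminf summable_diff sx sy) (auto intro!: mult_left_mono power_mono)
  also have "\<dots> = rayleigh_series h y - rayleigh_series h x"
    unfolding rayleigh_series_def by (rule suminf_diff[symmetric, OF sy sx])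
  finally show ?thesis .
qed

text \<open>
  The bound \<open>1 / 16\<close> on \<open>h\<close> makes the linear term at \<open>y = 1 / 2\<close>, which is \<open>1 / (8 (1 + h))\<close>, exceed \<open>h\<close>.
\<close>
lemma rayleigh_series_root:
  assumes "0 < h" "h \<le> 1 / 16"
  obtains y where "0 < y" "y < 1" "rayleigh_series h y = h"
proof -
  have cont: "isCont (rayleigh_series h) x" if "0 \<le> x" "x \<le> 1 / 2" for x
    unfolding rayleigh_series_def
    by (rule isCont_powser[where K = 1]) (use summable_scaled_rayleigh[of h] assms that in auto)
  have zero: "rayleigh_series h 0 = 0"
    by (simp add: rayleigh_series_def)
  have "h \<le> (1 / 2 - 0) / (4 * (1 + h))"
    using assms mult_mono[of h "1/16" h "1/16"] by (simp add: field_simps)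
  also have "\<dots> \<le> rayleigh_series h (1 / 2)"
    using rayleigh_series_expanding[of h 0 "1 / 2"] assms zero by simp
  finally have half: "h \<le> rayleigh_series h (1 / 2)" .
  then obtain y where y: "0 \<le> y" "y \<le> 1 / 2" "rayleigh_series h y = h"
    using IVT[of "rayleigh_series h" 0 h "1 / 2"] zero assms cont by auto
  moreover have "y \<noteq> 0"
    using y(3) zero assms by auto
  ultimately show ?thesis using that[of y] by auto
qed

section \<open>The Riccati equation of the logarithmic derivative\<close>

definition bessel_fps :: "real \<Rightarrow> complex fps" where
  "bessel_fps \<nu> = Abs_fps (\<lambda>j. (-1) ^ j * (1 / 4) ^ j / (fact j * pochhammer (of_real \<nu> + 1) j))"

text \<open>
  The series of \<open>F z = - z \<psi>' z / \<psi> z\<close>, where \<open>\<psi>\<close> is the sum of \<open>bessel_fps \<nu>\<close>. The sign makes its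
  coefficients nonnegative.
\<close>
definition log_deriv_fps :: "real \<Rightarrow> complex fps" where
  "log_deriv_fps \<nu> = - (fps_X * fps_deriv (bessel_fps \<nu>)) * inverse (bessel_fps \<nu>)"

lemma bessel_fps_nth_0 [simp]: "fps_nth (bessel_fps \<nu>) 0 = 1"
  by (simp add: bessel_fps_def)

text \<open>
  The Bessel differential equation in the form \<open>\<theta> (\<theta> \<psi>) + \<nu> \<theta> \<psi> + z \<psi> / 4 = 0\<close> with \<open>\<theta> = z d/dz\<close>,
  which is the two-term recurrence \<open>j (j + \<nu>) a\<^sub>j = - a\<^sub>j\<^sub>-\<^sub>1 / 4\<close> of the coefficients.
\<close>
lemma bessel_fps_ode:
  assumes "\<nu> > -1"
  shows "fps_X * fps_deriv (fps_X * fps_deriv (bessel_fps \<nu>))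
    + fps_const (of_real \<nu>) * (fps_X * fps_deriv (bessel_fps \<nu>))
    + fps_const (1 / 4) * (fps_X * bessel_fps \<nu>) = 0"
proof (rule fps_ext)
  fix j
  show "fps_nth (fps_X * fps_deriv (fps_X * fps_deriv (bessel_fps \<nu>))
    + fps_const (of_real \<nu>) * (fps_X * fps_deriv (bessel_fps \<nu>))
    + fps_const (1 / 4) * (fps_X * bessel_fps \<nu>)) j = fps_nth 0 j"
  proof (cases j)
    case (Suc i)
    have nz: "complex_of_real \<nu> + 1 + of_nat n \<noteq> 0" for n
    proof
      assume "complex_of_real \<nu> + 1 + of_nat n = 0"
      then have "Re (complex_of_real \<nu> + 1 + of_nat n) = 0" by simp
      then show False using assms by simp
    qed
    have p: "pochhammer (complex_of_real \<nu> + 1) i \<noteq> 0"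
      using nz by (auto simp: pochhammer_prod)
    show ?thesis
      unfolding Suc using nz[of i] p
      by (simp add: bessel_fps_def pochhammer_Suc divide_simps del: of_nat_Suc)
         (simp add: algebra_simps)
  qed simp
qed

lemma log_deriv_fps_mult:
  "log_deriv_fps \<nu> * bessel_fps \<nu> = - (fps_X * fps_deriv (bessel_fps \<nu>))"
  by (simp add: log_deriv_fps_def mult.assoc inverse_mult_eq_1)

text \<open>
  Substituting \<open>\<theta> \<psi> = - F \<psi>\<close> into the linear equation turns every term into a multiple of \<open>\<psi>\<close>, which
  cancels because formal power series over a field form a domain.
\<close>
lemma log_deriv_fps_riccati:
  assumes "\<nu> > -1"
  shows "fps_X * fps_deriv (log_deriv_fps \<nu>) + fps_const (of_real \<nu>) * log_deriv_fps \<nu>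
    = fps_const (1 / 4) * fps_X + log_deriv_fps \<nu> * log_deriv_fps \<nu>"
proof -
  let ?f = "log_deriv_fps \<nu>" and ?p = "bessel_fps \<nu>"
  have dp: "fps_X * fps_deriv ?p = - (?f * ?p)"
    using log_deriv_fps_mult[of \<nu>] by simp
  have "fps_X * fps_deriv (- (?f * ?p)) + fps_const (of_real \<nu>) * (- (?f * ?p))
      + fps_const (1 / 4) * (fps_X * ?p) = 0"
    using bessel_fps_ode[OF assms] unfolding dp .
  moreover have "fps_X * fps_deriv (- (?f * ?p)) = - (fps_X * fps_deriv ?f) * ?p - ?f * (fps_X * fps_deriv ?p)"
    by (simp add: algebra_simps)
  ultimately have "(fps_X * fps_deriv ?f + fps_const (of_real \<nu>) * ?f) * ?p
      = (fps_const (1 / 4) * fps_X + ?f * ?f) * ?p"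
    unfolding dp by (simp add: algebra_simps add_eq_0_iff2) (metis minus_minus)
  moreover have "?p \<noteq> 0"
    using bessel_fps_nth_0[of \<nu>] by (metis fps_zero_nth zero_neq_one)
  ultimately show ?thesis by simp
qed

text \<open>
  The Riccati equation and \<open>F 0 = 0\<close> determine all coefficients; the factor \<open>\<nu> (1 / \<nu>\<^sup>2)\<^sup>k\<close> is
  \<open>\<nu>\<^sup>1\<^sup>-\<^sup>2\<^sup>k\<close> without truncated subtraction, and turns \<open>k + \<nu>\<close> into \<open>1 + k h\<close>.
\<close>
lemma log_deriv_fps_nth:
  assumes "\<nu> > 0"
  shows "fps_nth (log_deriv_fps \<nu>) k = of_real (scaled_rayleigh (1 / \<nu>) k * \<nu> * (1 / \<nu>\<^sup>2) ^ k)"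
proof (induction k rule: less_induct)
  case (less k)
  let ?f = "log_deriv_fps \<nu>" and ?t = "scaled_rayleigh (1 / \<nu>)"
  have f0: "fps_nth ?f 0 = 0" by (simp add: log_deriv_fps_def)
  show ?case
  proof (cases "k = 0")
    case False
    have "of_nat k * fps_nth ?f k + of_real \<nu> * fps_nth ?f k
        = (if k = 1 then 1 / 4 else 0) + (\<Sum>n=0..k. fps_nth ?f n * fps_nth ?f (k - n))"
      using arg_cong[OF log_deriv_fps_riccati[of \<nu>], of "\<lambda>f. fps_nth f k"] assms False
      by (simp add: fps_mult_nth[of "log_deriv_fps \<nu>"])
    also have "(\<Sum>n=0..k. fps_nth ?f n * fps_nth ?f (k - n))
        = (\<Sum>n=1..k-1. fps_nth ?f n * fps_nth ?f (k - n))"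
      using False f0 by (cases k) (simp_all add: sum.atLeast_Suc_atMost)
    also have "\<dots> = (\<Sum>n=1..k-1. of_real (\<nu>\<^sup>2 * (1 / \<nu>\<^sup>2) ^ k * (?t n * ?t (k - n))))"
    proof (rule sum.cong)
      fix n assume n: "n \<in> {1..k-1}"
      then have "n + (k - n) = k" "n < k" "k - n < k"
        by auto
      then have "(1 / \<nu>\<^sup>2) ^ k = (1 / \<nu>\<^sup>2) ^ n * (1 / \<nu>\<^sup>2) ^ (k - n)"
        by (metis power_add)
      with \<open>n < k\<close> \<open>k - n < k\<close> show "fps_nth ?f n * fps_nth ?f (k - n) = of_real (\<nu>\<^sup>2 * (1 / \<nu>\<^sup>2) ^ k * (?t n * ?t (k - n)))"
        using n less[of n] less[of "k - n"]
        by (auto simp: power2_eq_square mult_ac)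
    qed auto
    also have "\<dots> = of_real (\<nu>\<^sup>2 * (1 / \<nu>\<^sup>2) ^ k * (\<Sum>n=1..k-1. ?t n * ?t (k - n)))"
      by (simp add: sum_distrib_left)
    also have "(if k = 1 then 1 / 4 else 0) = complex_of_real (\<nu>\<^sup>2 * (1 / \<nu>\<^sup>2) ^ k * (if k = 1 then 1 / 4 else 0))"
      using assms by simp
    also have "\<dots> + of_real (\<nu>\<^sup>2 * (1 / \<nu>\<^sup>2) ^ k * (\<Sum>n=1..k-1. ?t n * ?t (k - n)))
        = of_real (\<nu>\<^sup>2 * (1 / \<nu>\<^sup>2) ^ k * ((1 + real k * (1 / \<nu>)) * ?t k))"
      using scaled_rayleigh_rec[of "1 / \<nu>" k] assms
      by (simp only: of_real_add[symmetric] distrib_left[symmetric]) simp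
    also have "\<dots> = of_real (real k + \<nu>) * of_real (?t k * \<nu> * (1 / \<nu>\<^sup>2) ^ k)"
      using assms by (simp add: field_simps power2_eq_square flip: of_real_mult of_real_add)
    finally have "of_real (real k + \<nu>) * fps_nth ?f k = of_real (real k + \<nu>) * of_real (?t k * \<nu> * (1 / \<nu>\<^sup>2) ^ k)"
      by (simp add: algebra_simps)
    moreover have "complex_of_real (real k + \<nu>) \<noteq> 0"
      using assms by (subst of_real_eq_0_iff) linarith
    ultimately show ?thesis by (simp only: mult_cancel_left) simp
  qed (simp add: f0)
qed

section \<open>The radius of starlikeness as a root\<close>

lemma bessel_fps_term:
  "fps_nth (bessel_fps \<nu>) j * z ^ j = (-1) ^ j * (z / 4) ^ j / (fact j * pochhammer (of_real \<nu> + 1) j)"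
  by (simp add: bessel_fps_def power_divide)

lemma fps_conv_radius_bessel_fps:
  assumes "\<nu> > -1"
  shows "fps_conv_radius (bessel_fps \<nu>) = \<infinity>"
  unfolding fps_conv_radius_def
proof (rule conv_radius_inftyI'')
  fix z
  show "summable (\<lambda>n. fps_nth (bessel_fps \<nu>) n * z ^ n)"
    using summable_bessel_phi[OF assms, of z]
    by (simp only: bessel_fps_term)
qed

lemma bessel_phi_eq_eval_fps: "bessel_phi \<nu> z = z * eval_fps (bessel_fps \<nu>) z"
  by (simp only: bessel_phi_def eval_fps_def bessel_fps_term)

text \<open>
  In the variable \<open>w = z / \<nu>\<^sup>2\<close> the series of \<open>F\<close> is \<open>\<nu>\<close> times the series of \<open>scaled_rayleigh\<close>. In
  particular it converges for \<open>\<bar>w\<bar> \<le> 1\<close>.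
\<close>
lemma log_deriv_fps_term:
  assumes "\<nu> > 0"
  shows "fps_nth (log_deriv_fps \<nu>) k * (of_real (\<nu>\<^sup>2) * w) ^ k = of_real (\<nu> * scaled_rayleigh (1 / \<nu>) k) * w ^ k"
proof -
  have "(1 / \<nu>\<^sup>2) ^ k * (\<nu>\<^sup>2) ^ k = 1"
    using assms by (simp flip: power_mult_distrib)
  then have unit: "complex_of_real ((1 / \<nu>\<^sup>2) ^ k) * of_real (\<nu>\<^sup>2) ^ k = 1"
    by (simp flip: of_real_mult of_real_power)
  have "fps_nth (log_deriv_fps \<nu>) k * (of_real (\<nu>\<^sup>2) * w) ^ k =
      of_real (\<nu> * scaled_rayleigh (1 / \<nu>) k) * w ^ k * (of_real ((1 / \<nu>\<^sup>2) ^ k) * of_real (\<nu>\<^sup>2) ^ k)"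
    unfolding log_deriv_fps_nth[OF assms] power_mult_distrib of_real_mult by (simp only: mult_ac)
  then show ?thesis
    by (simp only: unit mult_1_right)
qed

lemma fps_conv_radius_log_deriv_fps:
  assumes "\<nu> > 0"
  shows "fps_conv_radius (log_deriv_fps \<nu>) \<ge> \<nu>\<^sup>2"
proof -
  have "summable (\<lambda>k. complex_of_real (\<nu> * scaled_rayleigh (1 / \<nu>) k))"
    using assms by (intro summable_of_real summable_mult summable_scaled_rayleigh) auto
  then have "summable (\<lambda>k. fps_nth (log_deriv_fps \<nu>) k * of_real (\<nu>\<^sup>2) ^ k)"
    using log_deriv_fps_term[OF assms, of _ 1] by simp
  from conv_radius_geI[OF this] show ?thesis
    by (simp add: fps_conv_radius_def norm_power)
qed

lemma norm_eval_log_deriv_fps_le: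
  assumes "\<nu> > 0" "norm w \<le> 1"
  shows "norm (eval_fps (log_deriv_fps \<nu>) (of_real (\<nu>\<^sup>2) * w)) \<le> \<nu> * rayleigh_series (1 / \<nu>) (norm w)"
proof -
  let ?t = "scaled_rayleigh (1 / \<nu>)"
  have summ: "summable (\<lambda>k. ?t k * norm w ^ k)"
    using assms by (intro summable_rayleigh_series) auto
  have norm: "norm (fps_nth (log_deriv_fps \<nu>) k * (of_real (\<nu>\<^sup>2) * w) ^ k) = \<nu> * (?t k * norm w ^ k)" for k
    using assms scaled_rayleigh_nonneg[of "1 / \<nu>" k]
    by (subst log_deriv_fps_term) (simp_all add: norm_mult norm_power)
  show ?thesis
    using summable_norm[of "\<lambda>k. fps_nth (log_deriv_fps \<nu>) k * (of_real (\<nu>\<^sup>2) * w) ^ k"]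
    unfolding eval_fps_def rayleigh_series_def norm using summ
    by (simp add: suminf_mult summable_mult)
qed

lemma eval_log_deriv_fps_of_real:
  assumes "\<nu> > 0" "0 \<le> y" "y \<le> 1"
  shows "eval_fps (log_deriv_fps \<nu>) (of_real (\<nu>\<^sup>2 * y)) = of_real (\<nu> * rayleigh_series (1 / \<nu>) y)"
proof -
  have summ: "summable (\<lambda>k. scaled_rayleigh (1 / \<nu>) k * y ^ k)"
    using assms by (intro summable_rayleigh_series) auto
  have "eval_fps (log_deriv_fps \<nu>) (of_real (\<nu>\<^sup>2 * y)) =
      (\<Sum>k. complex_of_real (\<nu> * (scaled_rayleigh (1 / \<nu>) k * y ^ k)))"
    unfolding eval_fps_def using log_deriv_fps_term[OF assms(1), of _ "of_real y"]
    by (simp add: mult_ac)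
  also have "\<dots> = of_real (\<Sum>k. \<nu> * (scaled_rayleigh (1 / \<nu>) k * y ^ k))"
    by (rule suminf_of_real[symmetric]) (intro summable_mult summ)
  finally show ?thesis
    using summ by (simp add: suminf_mult rayleigh_series_def)
qed

lemma eval_log_deriv_fps_mult:
  assumes "\<nu> > 0" "norm z < \<nu>\<^sup>2"
  shows "eval_fps (log_deriv_fps \<nu>) z * eval_fps (bessel_fps \<nu>) z =
    - (z * eval_fps (fps_deriv (bessel_fps \<nu>)) z)"
proof -
  have inf: "fps_conv_radius (bessel_fps \<nu>) = \<infinity>"
    using assms by (intro fps_conv_radius_bessel_fps) auto
  then have inf': "fps_conv_radius (fps_deriv (bessel_fps \<nu>)) = \<infinity>"
    using fps_conv_radius_deriv[of "bessel_fps \<nu>"] by simp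
  have "ereal (norm z) < fps_conv_radius (log_deriv_fps \<nu>)"
    using assms(2) fps_conv_radius_log_deriv_fps[OF assms(1)]
    by (metis ereal_less_eq(3) less_ereal.simps(1) order_less_le_trans)
  then have "eval_fps (log_deriv_fps \<nu> * bessel_fps \<nu>) z = eval_fps (log_deriv_fps \<nu>) z * eval_fps (bessel_fps \<nu>) z"
    by (intro eval_fps_mult) (auto simp: inf)
  moreover have "fps_conv_radius (fps_X * fps_deriv (bessel_fps \<nu>)) = \<infinity>"
    using fps_conv_radius_mult[of fps_X "fps_deriv (bessel_fps \<nu>)"] inf' by simp
  then have "eval_fps (- (fps_X * fps_deriv (bessel_fps \<nu>))) z = - (z * eval_fps (fps_deriv (bessel_fps \<nu>)) z)"
    by (subst eval_fps_minus) (auto simp: eval_fps_mult inf')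
  ultimately show ?thesis
    by (simp add: log_deriv_fps_mult)
qed

text \<open>
  That \<open>F\<close> is analytic on the disc of radius \<open>\<nu>\<^sup>2\<close> already excludes zeros of \<open>\<psi>\<close> there: if \<open>h\<close> is a
  primitive of \<open>F z / z\<close>, then \<open>\<psi> exp h\<close> has derivative zero, so it is a constant, which is nonzero by
  its value at the origin.
\<close>
lemma eval_bessel_fps_nonzero:
  assumes "\<nu> > 0" "norm z < \<nu>\<^sup>2"
  shows "eval_fps (bessel_fps \<nu>) z \<noteq> 0"
proof -
  let ?p = "eval_fps (bessel_fps \<nu>)" and ?g = "eval_fps (fps_shift 1 (log_deriv_fps \<nu>))"
  let ?D = "ball 0 (\<nu>\<^sup>2) :: complex set"
  have p': "(?p has_field_derivative eval_fps (fps_deriv (bessel_fps \<nu>)) w) (at w within A)" for w A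
    using assms by (intro has_field_derivative_eval_fps) (simp add: fps_conv_radius_bessel_fps)
  have radius: "?D \<subseteq> eball 0 (fps_conv_radius (log_deriv_fps \<nu>))"
    by (rule ball_eball_mono[OF fps_conv_radius_log_deriv_fps[OF assms(1)]])
  have "?g holomorphic_on ?D"
    using radius by (intro holomorphic_intros) auto
  then obtain h where h: "\<And>w. w \<in> ?D \<Longrightarrow> (h has_field_derivative ?g w) (at w within ?D)"
    using holomorphic_convex_primitive'[of ?D ?g] assms by auto
  have pg: "eval_fps (fps_deriv (bessel_fps \<nu>)) w = - ?g w * ?p w" if w: "w \<in> ?D" "w \<noteq> 0" for w
  proof -
    have "eval_fps (log_deriv_fps \<nu>) w = w * ?g w"
    proof -
      have "log_deriv_fps \<nu> = fps_X * fps_shift 1 (log_deriv_fps \<nu>)"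
        by (rule fps_ext) (simp add: log_deriv_fps_def)
      then have "eval_fps (log_deriv_fps \<nu>) w = eval_fps (fps_X * fps_shift 1 (log_deriv_fps \<nu>)) w"
        by simp
      also have "\<dots> = w * ?g w"
        using w radius by (subst eval_fps_mult) auto
      finally show ?thesis .
    qed
    then have "w * (?g w * ?p w) = w * (- eval_fps (fps_deriv (bessel_fps \<nu>)) w)"
      using eval_log_deriv_fps_mult[OF assms(1), of w] w by (simp add: mult.assoc)
    then show ?thesis using w(2) by (simp only: mult_cancel_left) simp
  qed
  have pg0: "eval_fps (fps_deriv (bessel_fps \<nu>)) 0 = - ?g 0 * ?p 0"
    by (simp add: eval_fps_at_0 log_deriv_fps_def fps_mult_nth)
  have "((\<lambda>w. ?p w * exp (h w)) has_field_derivative 0) (at w within ?D)" if "w \<in> ?D" for w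
  proof -
    have "eval_fps (fps_deriv (bessel_fps \<nu>)) w = - ?g w * ?p w"
      using pg pg0 that by (cases "w = 0") auto
    then show ?thesis
      using assms by (auto intro!: derivative_eq_intros p' h[OF that] simp: fps_conv_radius_bessel_fps)
  qed
  then obtain c where c: "\<And>w. w \<in> ?D \<Longrightarrow> ?p w * exp (h w) = c"
    using has_field_derivative_zero_constant[of ?D "\<lambda>w. ?p w * exp (h w)"] by auto
  have "c \<noteq> 0"
    using c[of 0] assms by (auto simp: eval_fps_at_0)
  then show ?thesis
    using c[of z] assms by auto
qed

lemma bessel_phi_log_deriv:
  assumes "\<nu> > 0" "norm z < \<nu>\<^sup>2" "z \<noteq> 0"
  shows "bessel_phi \<nu> z \<noteq> 0"
    and "z * deriv (bessel_phi \<nu>) z / bessel_phi \<nu> z = 1 - eval_fps (log_deriv_fps \<nu>) z"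
proof -
  let ?p = "eval_fps (bessel_fps \<nu>)" and ?p' = "eval_fps (fps_deriv (bessel_fps \<nu>))"
  note nz = eval_bessel_fps_nonzero[OF assms(1,2)]
  then show "bessel_phi \<nu> z \<noteq> 0"
    using assms by (simp add: bessel_phi_eq_eval_fps)
  have "((\<lambda>z. z * ?p z) has_field_derivative ?p z + z * ?p' z) (at z)"
    using assms by (auto intro!: derivative_eq_intros has_field_derivative_eval_fps simp: fps_conv_radius_bessel_fps)
  then have "deriv (bessel_phi \<nu>) z = ?p z + z * ?p' z"
    using DERIV_imp_deriv ext[of "bessel_phi \<nu>", OF bessel_phi_eq_eval_fps] by metis
  also have "z * ?p' z = - (eval_fps (log_deriv_fps \<nu>) z * ?p z)"
    using eval_log_deriv_fps_mult[OF assms(1,2)] by simp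
  finally show "z * deriv (bessel_phi \<nu>) z / bessel_phi \<nu> z = 1 - eval_fps (log_deriv_fps \<nu>) z"
    using nz assms by (simp add: bessel_phi_eq_eval_fps[of \<nu> z] field_simps)
qed

text \<open>
  Inside the disc of radius \<open>\<nu>\<^sup>2 y\<close> one has \<open>\<bar>F z\<bar> \<le> F \<bar>z\<bar> < 1\<close> by positivity of the coefficients and
  monotonicity, while at the boundary point \<open>z = \<nu>\<^sup>2 y\<close> the quotient \<open>1 - F z\<close> vanishes; so \<open>\<nu>\<^sup>2 y\<close> is the
  largest admissible radius.
\<close>
lemma radius_of_starlikeness_bessel_phi:
  assumes \<nu>: "\<nu> > 0" and y: "0 < y" "y < 1" "rayleigh_series (1 / \<nu>) y = 1 / \<nu>"
  shows "radius_of_starlikeness (bessel_phi \<nu>) = \<nu>\<^sup>2 * y"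
  unfolding radius_of_starlikeness_def
proof (rule cSup_eq_maximum)
  have "bessel_phi \<nu> z \<noteq> 0 \<and> Re (z * deriv (bessel_phi \<nu>) z / bessel_phi \<nu> z) > 0"
    if z: "z \<in> ball 0 (\<nu>\<^sup>2 * y)" "z \<noteq> 0" for z
  proof -
    define w where "w = z / of_real (\<nu>\<^sup>2)"
    have zw: "z = of_real (\<nu>\<^sup>2) * w"
      using \<nu> by (simp add: w_def)
    have w: "norm w < y"
      using z \<nu> by (simp add: w_def norm_divide norm_power field_simps)
    have "norm z < \<nu>\<^sup>2"
      using w y \<nu> by (simp add: zw norm_mult norm_power)
    note quotient = bessel_phi_log_deriv[OF \<nu> this z(2)]
    have "(y - norm w) / (4 * (1 + 1 / \<nu>)) > 0"
      using w \<nu> by (intro divide_pos_pos) (auto intro!: add_pos_pos)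
    then have "rayleigh_series (1 / \<nu>) (norm w) < 1 / \<nu>"
      using rayleigh_series_expanding[of "1 / \<nu>" "norm w" y] w y \<nu> by auto
    then have "\<nu> * rayleigh_series (1 / \<nu>) (norm w) < 1"
      using \<nu> by (simp add: field_simps)
    then have "norm (eval_fps (log_deriv_fps \<nu>) z) < 1"
      using norm_eval_log_deriv_fps_le[OF \<nu>, of w] w y by (simp add: zw)
    then have "Re (eval_fps (log_deriv_fps \<nu>) z) < 1"
      using complex_Re_le_cmod order_le_less_trans by blast
    then show ?thesis
      using quotient by simp
  qed
  then show "\<nu>\<^sup>2 * y \<in> {r. r > 0 \<and> (\<forall>z\<in>ball 0 r. z \<noteq> 0 \<longrightarrow>
      bessel_phi \<nu> z \<noteq> 0 \<and> Re (z * deriv (bessel_phi \<nu>) z / bessel_phi \<nu> z) > 0)}"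
    using \<nu> y by auto
next
  fix r
  assume r: "r \<in> {r. r > 0 \<and> (\<forall>z\<in>ball 0 r. z \<noteq> 0 \<longrightarrow>
      bessel_phi \<nu> z \<noteq> 0 \<and> Re (z * deriv (bessel_phi \<nu>) z / bessel_phi \<nu> z) > 0)}"
  show "r \<le> \<nu>\<^sup>2 * y"
  proof (rule ccontr)
    assume "\<not> r \<le> \<nu>\<^sup>2 * y"
    moreover define z where "z = complex_of_real (\<nu>\<^sup>2 * y)"
    moreover have "norm z = \<nu>\<^sup>2 * y"
      unfolding z_def norm_of_real using y by simp
    ultimately have "z \<in> ball 0 r" "z \<noteq> 0" "norm z < \<nu>\<^sup>2"
      using y \<nu> by auto
    then have "Re (1 - eval_fps (log_deriv_fps \<nu>) z) > 0"
      using r bessel_phi_log_deriv(2)[OF \<nu>, of z] by auto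
    moreover have "eval_fps (log_deriv_fps \<nu>) z = 1"
      unfolding z_def using eval_log_deriv_fps_of_real[OF \<nu>, of y] y \<nu> by simp
    ultimately show False by simp
  qed
qed

section \<open>The coefficients \<open>\<sigma>\<close> as Taylor coefficients\<close>

definition sigma_fps :: "nat \<Rightarrow> real fps" where
  "sigma_fps k = Abs_fps (sigma_coeff k)"

lemma sigma_fps_nth [simp]: "fps_nth (sigma_fps k) m = sigma_coeff k m"
  by (simp add: sigma_fps_def)

lemma sigma_coeff_1: "sigma_coeff (Suc 0) m = (-1) ^ m / 4"
  by (subst sigma_coeff.simps) simp

lemma inverse_one_plus_const_fps_X:
  "inverse (1 + fps_const c * fps_X) = Abs_fps (\<lambda>i. (- c :: real) ^ i)"
proof (rule fps_inverse_unique, rule fps_ext)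
  fix n
  show "fps_nth ((1 + fps_const c * fps_X) * Abs_fps (\<lambda>i. (- c) ^ i)) n = fps_nth 1 n"
    by (cases n) (simp_all add: distrib_right mult.assoc)
qed

lemma sigma_fps_1: "sigma_fps (Suc 0) = fps_const (1 / 4) * inverse (1 + fps_const 1 * fps_X)"
  unfolding inverse_one_plus_const_fps_X
  by (rule fps_ext) (simp add: sigma_coeff_1)

text \<open>
  The factor \<open>(-k)\<^sup>m\<^sup>-\<^sup>i\<close> in the definition of \<open>sigma_coeff\<close> is the expansion of \<open>1 / (1 + k h)\<close>, the inner
  sums are convolutions: this is the recurrence of \<open>scaled_rayleigh\<close>.
\<close>
lemma sigma_fps_rec:
  assumes "k \<noteq> 1"
  shows "sigma_fps k =
    (\<Sum>n=1..k-1. sigma_fps n * sigma_fps (k - n)) * inverse (1 + fps_const (real k) * fps_X)"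
  unfolding inverse_one_plus_const_fps_X
proof (rule fps_ext)
  fix m
  have "fps_nth (sigma_fps k) m = (\<Sum>i=0..m. \<Sum>j=0..i. \<Sum>n=1..k-1.
      (- real k) ^ (m - i) * sigma_coeff n j * sigma_coeff (k - n) (i - j))"
    using assms by (simp add: sigma_fps_def sigma_coeff.simps[of k])
  also have "\<dots> = (\<Sum>i=0..m. \<Sum>n=1..k-1. \<Sum>j=0..i.
      (- real k) ^ (m - i) * sigma_coeff n j * sigma_coeff (k - n) (i - j))"
    by (intro sum.cong refl sum.swap)
  also have "\<dots> = (\<Sum>i=0..m. fps_nth (\<Sum>n=1..k-1. sigma_fps n * sigma_fps (k - n)) i * (- real k) ^ (m - i))"
    by (simp only: fps_sum_nth fps_mult_nth sigma_fps_nth sum_distrib_left sum_distrib_right mult_ac)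
  also have "\<dots> = fps_nth ((\<Sum>n=1..k-1. sigma_fps n * sigma_fps (k - n)) * Abs_fps (\<lambda>i. (- real k) ^ i)) m"
    by (simp only: fps_mult_nth[of _ "Abs_fps _"] fps_nth_Abs_fps)
  finally show "fps_nth (sigma_fps k) m = \<dots>" .
qed

lemma scaled_rayleigh_has_fps_expansion:
  assumes "k > 0"
  shows "(\<lambda>h. scaled_rayleigh h k) has_fps_expansion sigma_fps k"
  using assms
proof (induction k rule: less_induct)
  case (less k)
  have inv: "(\<lambda>h. inverse (1 + real k * h)) has_fps_expansion inverse (1 + fps_const (real k) * fps_X)"
    by (intro fps_expansion_intros) simp
  show ?case
  proof (cases "k = 1")
    case True
    have "(\<lambda>h. 1 / 4 * inverse (1 + real k * h)) has_fps_expansion fps_const (1 / 4) * inverse (1 + fps_const (real k) * fps_X)"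
      by (intro has_fps_expansion_cmult_left inv)
    then show ?thesis
      using True by (simp add: sigma_fps_1 scaled_rayleigh_1 field_simps)
  next
    case False
    have "(\<lambda>h. (\<Sum>n=1..k-1. scaled_rayleigh h n * scaled_rayleigh h (k - n)) * inverse (1 + real k * h))
        has_fps_expansion sigma_fps k"
      unfolding sigma_fps_rec[OF False]
      by (intro has_fps_expansion_mult has_fps_expansion_sum inv less.IH) auto
    moreover have "scaled_rayleigh h k =
        (\<Sum>n=1..k-1. scaled_rayleigh h n * scaled_rayleigh h (k - n)) * inverse (1 + real k * h)" for h
      using False by (subst scaled_rayleigh.simps) (simp add: divide_inverse)
    ultimately show ?thesis by simp
  qed
qed

section \<open>The formal solution and its truncations\<close>

lemma has_fps_expansion_imp_bigo:
  fixes F :: "real fps"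
  assumes "f has_fps_expansion F" "\<And>n. n < N \<Longrightarrow> fps_nth F n = 0"
  shows "f \<in> O[at_right 0](\<lambda>x. x ^ N)"
proof (cases "F = 0")
  case True
  have "eventually (\<lambda>x. eval_fps F x = f x) (nhds 0)"
    using assms(1) by (simp add: has_fps_expansion_def)
  then have "eventually (\<lambda>x. eval_fps F x = f x) (at_right 0)"
    by (rule filter_leD[OF at_within_le_nhds])
  then have "eventually (\<lambda>x. norm (f x) \<le> 0 * norm (x ^ N)) (at_right 0)"
    by eventually_elim (use True in auto)
  then show ?thesis
    by (rule bigoI)
next
  case False
  define g where "g = (\<lambda>x. if x = 0 then fps_nth F N else f x / x ^ N)"
  have "g has_fps_expansion fps_shift N F"
    unfolding g_def using assms False by (intro has_fps_expansion_shift subdegree_geI) auto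
  then have "(g \<longlongrightarrow> g 0) (at_right 0)"
    using has_fps_expansion_imp_continuous by (auto simp: continuous_within)
  moreover have "eventually (\<lambda>x. g x = f x / x ^ N) (at_right (0 :: real))"
    using eventually_at_right_less[of 0] by eventually_elim (auto simp: g_def)
  ultimately have "((\<lambda>x. f x / x ^ N) \<longlongrightarrow> g 0) (at_right 0)"
    by (rule Lim_transform_eventually)
  moreover have "eventually (\<lambda>x. x ^ N \<noteq> 0) (at_right (0 :: real))"
    using eventually_at_right_less[of 0] by eventually_elim auto
  ultimately show ?thesis
    using bigoI_tendsto[of f "\<lambda>x. x ^ N" "g 0" "at_right 0"] by blast
qed

definition eps_fps :: "real fps" where
  "eps_fps = Abs_fps (\<lambda>i. if i = 0 then 1 else eps_coeff i)"

lemma sum_sigma_potential_poly: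
  "(\<Sum>m=0..j. sigma_coeff n (j - m) * potential_poly (real n) m eps_coeff) =
    fps_nth (sigma_fps n * eps_fps ^ n) j"
  unfolding mult.commute[of "sigma_fps n"] fps_mult_nth[of "eps_fps ^ n"]
  by (simp only: potential_poly_of_nat sigma_fps_nth eps_fps_def mult.commute)

text \<open>
  For every \<open>k > 0\<close> the coefficient of \<open>h\<^sup>k\<^sup>+\<^sup>1\<close> in \<open>\<Sum>n. t\<^sub>n (4 h (1 + \<Sum>i. \<epsilon>\<^sub>i h\<^sup>i))\<^sup>n\<close> vanishes. The
  term \<open>n = 1\<close> contributes \<open>\<epsilon>\<^sub>k\<close> and the alternating sum of its predecessors, and the recursion of
  \<open>eps_coeff\<close> is the equation solved for \<open>\<epsilon>\<^sub>k\<close>.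
\<close>
lemma formal_equation:
  assumes "k > 0"
  shows "(\<Sum>n=1..k+1. 4 ^ n * fps_nth (sigma_fps n * eps_fps ^ n) (k + 1 - n)) = 0"
proof -
  have "(\<Sum>n=1..k+1. 4 ^ n * fps_nth (sigma_fps n * eps_fps ^ n) (k + 1 - n)) =
      4 * fps_nth (sigma_fps 1 * eps_fps) k +
      (\<Sum>n=2..k+1. 4 ^ n * fps_nth (sigma_fps n * eps_fps ^ n) (k + 1 - n))"
    using assms by (subst sum.atLeast_Suc_atMost) (auto simp: numeral_2_eq_2)
  also have "4 * fps_nth (sigma_fps 1 * eps_fps) k = (\<Sum>m=0..k. (-1) ^ (k - m) * fps_nth eps_fps m)"
    by (subst mult.commute[of "sigma_fps 1"])
       (simp add: fps_mult_nth[of eps_fps] sigma_coeff_1 sum_distrib_left mult.commute)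
  also have "\<dots> = (-1) ^ k + (\<Sum>n=1..k-1. (-1) ^ (k - n) * eps_coeff n) + eps_coeff k"
    using assms by (cases k) (simp_all add: sum.atLeast_Suc_atMost eps_fps_def)
  finally show ?thesis
    using eps_coeff.simps[of k] by (simp only: sum_sigma_potential_poly) simp
qed

definition eps_trunc :: "nat \<Rightarrow> real \<Rightarrow> real" where
  "eps_trunc N h = 1 + (\<Sum>k=1..N-1. eps_coeff k * h ^ k)"

lemma eps_trunc_has_fps_expansion:
  assumes "N \<ge> 1"
  obtains E where "eps_trunc N has_fps_expansion E"
    and "\<And>i. i < N \<Longrightarrow> fps_nth E i = fps_nth eps_fps i"
proof
  let ?E = "1 + (\<Sum>k=1..N-1. fps_const (eps_coeff k) * fps_X ^ k)"
  show "eps_trunc N has_fps_expansion ?E"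
    unfolding eps_trunc_def by (intro fps_expansion_intros)
  fix i assume "i < N"
  have "fps_nth ?E i = (if i = 0 then 1 else 0) + (\<Sum>k=1..N-1. if k = i then eps_coeff k else 0)"
    unfolding fps_add_nth fps_sum_nth
    by (intro arg_cong2[where f = "(+)"] sum.cong) auto
  also have "\<dots> = fps_nth eps_fps i"
    using \<open>i < N\<close> by (auto simp: eps_fps_def sum.delta)
  finally show "fps_nth ?E i = fps_nth eps_fps i" .
qed

text \<open>
  The \<open>k\<close>-th term carries the factor \<open>h\<^sup>k\<close> with \<open>k \<ge> 1\<close>. So for \<open>n \<le> N\<close> only terms with \<open>k \<le> N\<close>
  contribute to the coefficient of \<open>h\<^sup>n\<close>, and only through \<open>\<epsilon>\<^sub>i\<close> with \<open>i < N\<close>, where the truncated and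
  the formal solution agree.
\<close>
lemma truncated_equation_bigo:
  assumes N: "N \<ge> 1"
  shows "(\<lambda>h. (\<Sum>k=1..N. scaled_rayleigh h k * (4 * h * eps_trunc N h) ^ k) - h)
    \<in> O[at_right 0](\<lambda>h. h ^ (N + 1))"
proof -
  obtain E where E: "eps_trunc N has_fps_expansion E"
    and E_nth: "\<And>i. i < N \<Longrightarrow> fps_nth E i = fps_nth eps_fps i"
    using eps_trunc_has_fps_expansion[OF N] by blast
  have "(\<lambda>h. (\<Sum>k=1..N. scaled_rayleigh h k * (4 * h * eps_trunc N h) ^ k) - h)
      has_fps_expansion (\<Sum>k=1..N. sigma_fps k * (fps_const 4 * fps_X * E) ^ k) - fps_X"
    by (intro fps_expansion_intros scaled_rayleigh_has_fps_expansion E) auto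
  then show ?thesis
  proof (rule has_fps_expansion_imp_bigo)
    fix n assume n: "n < N + 1"
    have nth: "fps_nth (sigma_fps k * (fps_const 4 * fps_X * E) ^ k) n =
        (if n < k then 0 else 4 ^ k * fps_nth (sigma_fps k * eps_fps ^ k) (n - k))" if "k \<ge> 1" for k
    proof -
      have scale: "sigma_fps k * (fps_const 4 * fps_X * E) ^ k = fps_const (4 ^ k) * (fps_X ^ k * (sigma_fps k * E ^ k))"
        by (simp add: power_mult_distrib fps_const_power mult_ac)
      have "fps_nth (sigma_fps k * E ^ k) (n - k) = fps_nth (sigma_fps k * eps_fps ^ k) (n - k)" if "k \<le> n"
        unfolding fps_mult_nth
        using n \<open>k \<ge> 1\<close> that by (intro sum.cong refl arg_cong2[where f = "(*)"] fps_power_nth_cong[where n = "n - k"] E_nth) auto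
      then show ?thesis
        unfolding scale by (cases "n < k") (simp_all add: fps_X_power_mult_nth)
    qed
    have "fps_nth (\<Sum>k=1..N. sigma_fps k * (fps_const 4 * fps_X * E) ^ k) n =
        (\<Sum>k=1..N. if n < k then 0 else 4 ^ k * fps_nth (sigma_fps k * eps_fps ^ k) (n - k))"
      by (simp add: fps_sum_nth nth)
    also have "\<dots> = (\<Sum>k=1..n. 4 ^ k * fps_nth (sigma_fps k * eps_fps ^ k) (n - k))"
      using n by (intro sum.mono_neutral_cong_right) auto
    also have "\<dots> = fps_nth fps_X n"
    proof (cases "n \<le> 1")
      case True
      then consider "n = 0" | "n = 1" by linarith
      then show ?thesis
        by cases (simp_all add: eps_fps_def sigma_coeff_1)
    next
      case False
      then show ?thesis using formal_equation[of "n - 1"] by (simp add: le_imp_diff_is_add)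
    qed
    finally show "fps_nth ((\<Sum>k=1..N. sigma_fps k * (fps_const 4 * fps_X * E) ^ k) - fps_X) n = 0"
      by simp
  qed
qed

text \<open>
  Since \<open>\<Sum>k. t\<^sub>k \<le> 1\<close> uniformly in \<open>h\<close>, the bound does not depend on \<open>h\<close>, although \<open>y\<close> will.
\<close>
lemma rayleigh_series_remainder:
  assumes h: "h \<ge> 0" and y: "0 \<le> y" "y \<le> 1"
  shows "\<bar>rayleigh_series h y - (\<Sum>k=1..N. scaled_rayleigh h k * y ^ k)\<bar> \<le> y ^ (N + 1)"
proof -
  let ?t = "scaled_rayleigh h"
  note nonneg = scaled_rayleigh_nonneg[OF h]
  note summ = summable_scaled_rayleigh[OF h] summable_rayleigh_series[OF h y]
  have "rayleigh_series h y = (\<Sum>k. ?t (k + (N + 1)) * y ^ (k + (N + 1))) + (\<Sum>k<N+1. ?t k * y ^ k)"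
    unfolding rayleigh_series_def by (rule suminf_split_initial_segment[OF summ(2), of "N + 1"])
  also have "(\<Sum>k<N+1. ?t k * y ^ k) = (\<Sum>k=1..N. ?t k * y ^ k)"
  proof -
    have "{..<N+1} = insert 0 {1..N}"
      by auto
    then show ?thesis
      by simp
  qed
  finally have diff: "rayleigh_series h y - (\<Sum>k=1..N. ?t k * y ^ k) =
      (\<Sum>k. ?t (k + (N + 1)) * y ^ (k + (N + 1)))"
    by simp
  have summ_tail: "summable (\<lambda>k. ?t (k + (N + 1)) * y ^ (k + (N + 1)))"
    using summ(2) by (rule summable_ignore_initial_segment)
  have "0 \<le> (\<Sum>k. ?t (k + (N + 1)) * y ^ (k + (N + 1)))"
    using y nonneg by (intro suminf_nonneg summ_tail mult_nonneg_nonneg zero_le_power)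
  moreover have "(\<Sum>k. ?t (k + (N + 1)) * y ^ (k + (N + 1))) \<le> (\<Sum>k. ?t (k + (N + 1)) * y ^ (N + 1))"
  proof (rule suminf_le)
    fix k
    have "y ^ (k + (N + 1)) \<le> y ^ (N + 1)"
      using y by (intro power_decreasing) auto
    then show "?t (k + (N + 1)) * y ^ (k + (N + 1)) \<le> ?t (k + (N + 1)) * y ^ (N + 1)"
      by (intro mult_left_mono nonneg)
  qed (intro summ_tail summable_mult2 summable_ignore_initial_segment summ)+
  moreover have "(\<Sum>k. ?t (k + (N + 1)) * y ^ (N + 1)) = (\<Sum>k. ?t (k + (N + 1))) * y ^ (N + 1)"
    using summ(1) by (intro suminf_mult2[symmetric] summable_ignore_initial_segment)
  moreover have "(\<Sum>k. ?t (k + (N + 1))) \<le> 1"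
  proof -
    have "(\<Sum>k. ?t (k + (N + 1))) \<le> (\<Sum>k. ?t k)"
      using suminf_split_initial_segment[OF summ(1), of "N + 1"] sum_nonneg[of "{..<N + 1}" ?t] nonneg by simp
    also have "\<dots> \<le> 1"
    proof (rule suminf_le_const[OF summ(1)])
      fix n show "(\<Sum>k<n. ?t k) \<le> 1"
        using sum_scaled_rayleigh_le[OF h, of "n - 1"] by (cases n) (auto simp: lessThan_Suc_atMost)
    qed
    finally show ?thesis .
  qed
  then have "(\<Sum>k. ?t (k + (N + 1))) * y ^ (N + 1) \<le> 1 * y ^ (N + 1)"
    using y by (intro mult_right_mono) auto
  ultimately show ?thesis
    unfolding diff by simp
qed

section \<open>The asymptotic expansion\<close>

text \<open>
  Let \<open>y\<close> be the root and \<open>y' = 4 h (1 + \<dots>)\<close> the truncated formal solution. Then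
  \<open>\<bar>y - y'\<bar> \<le> 4 (1 + h) \<bar>S y - S y'\<bar> = 4 (1 + h) \<bar>h - S y'\<bar> = O(h\<^sup>N\<^sup>+\<^sup>1)\<close>; one power of \<open>h\<close> is lost on dividing
  by \<open>4 h\<close>, since the normalized radius is \<open>y / (4 h)\<close>.
\<close>
lemma radius_expansion_at_zero:
  assumes N: "N \<ge> 1"
  shows "(\<lambda>h. radius_of_starlikeness (bessel_phi (1 / h)) * h / 4 - eps_trunc N h)
    \<in> O[at_right 0](\<lambda>h. h ^ N)"
proof -
  let ?y = "\<lambda>h. 4 * h * eps_trunc N h"
  let ?P = "\<lambda>h. (\<Sum>k=1..N. scaled_rayleigh h k * ?y h ^ k) - h"
  obtain E where E: "eps_trunc N has_fps_expansion E"
    using eps_trunc_has_fps_expansion[OF N] by blast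
  have lim: "(eps_trunc N \<longlongrightarrow> 1) (at_right 0)"
    using has_fps_expansion_imp_continuous[OF E, of "{0<..}"] N
    by (simp add: continuous_within eps_trunc_def)
  have small: "eventually (\<lambda>h. 0 < h \<and> h < 1 / 16) (at_right (0 :: real))"
    by (intro eventually_conj eventually_at_right_less eventually_at_rightI[of 0 "1 / 16"]) auto
  have U: "eventually (\<lambda>h. 0 < eps_trunc N h \<and> eps_trunc N h < 2) (at_right 0)"
    using lim by (intro eventually_conj order_tendstoD) auto
  have "(\<lambda>h. ?y h ^ (N + 1)) \<in> O[at_right 0](\<lambda>h. h ^ (N + 1))"
  proof (rule has_fps_expansion_imp_bigo)
    show "(\<lambda>h. ?y h ^ (N + 1)) has_fps_expansion (fps_const 4 * fps_X * E) ^ (N + 1)"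
      by (intro fps_expansion_intros E)
    fix n assume n: "n < N + 1"
    have "(fps_const 4 * fps_X * E) ^ (N + 1) = fps_X ^ (N + 1) * (fps_const 4 * E) ^ (N + 1)"
      by (simp only: power_mult_distrib mult_ac)
    then show "fps_nth ((fps_const 4 * fps_X * E) ^ (N + 1)) n = 0"
      using n by (simp only: fps_X_power_mult_nth if_True)
  qed
  then have rhs: "(\<lambda>h. \<bar>?P h\<bar> + \<bar>?y h ^ (N + 1)\<bar>) \<in> O[at_right 0](\<lambda>h. h ^ (N + 1))"
    using truncated_equation_bigo[OF N] by (intro sum_in_bigo) auto
  have "eventually (\<lambda>h. norm (4 * h * (radius_of_starlikeness (bessel_phi (1 / h)) * h / 4 - eps_trunc N h))
      \<le> 8 * norm (\<bar>?P h\<bar> + \<bar>?y h ^ (N + 1)\<bar>)) (at_right 0)"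
    using small U
  proof eventually_elim
    case (elim h)
    let ?S = "rayleigh_series h"
    obtain y where y: "0 < y" "y < 1" "?S y = h"
      using rayleigh_series_root[of h] elim by auto
    have "radius_of_starlikeness (bessel_phi (1 / h)) = (1 / h)\<^sup>2 * y"
      using radius_of_starlikeness_bessel_phi[of "1 / h" y] elim y by simp
    then have r: "4 * h * (radius_of_starlikeness (bessel_phi (1 / h)) * h / 4 - eps_trunc N h) = y - ?y h"
      using elim by (simp add: field_simps power2_eq_square)
    have "h * eps_trunc N h \<le> 1 / 16 * 2"
      using elim by (intro mult_mono) auto
    then have y': "0 \<le> ?y h" "?y h \<le> 1"
      using elim by auto
    have "\<bar>y - ?y h\<bar> / (4 * (1 + h)) \<le> \<bar>?S y - ?S (?y h)\<bar>"
      using rayleigh_series_expanding[of h y "?y h"] rayleigh_series_expanding[of h "?y h" y] elim y y'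
      by (cases "y \<le> ?y h") (auto simp: abs_if)
    then have "\<bar>y - ?y h\<bar> \<le> 4 * (1 + h) * \<bar>?S y - ?S (?y h)\<bar>"
      using elim by (simp add: field_simps)
    also have "\<dots> \<le> 8 * \<bar>?S y - ?S (?y h)\<bar>"
      using elim by (intro mult_right_mono) auto
    also have "\<bar>?S y - ?S (?y h)\<bar> \<le> \<bar>?P h\<bar> + \<bar>?y h ^ (N + 1)\<bar>"
      using rayleigh_series_remainder[of h "?y h" N] elim y' y(3) by linarith
    finally show ?case
      unfolding r by simp
  qed
  then have "(\<lambda>h. 4 * h * (radius_of_starlikeness (bessel_phi (1 / h)) * h / 4 - eps_trunc N h))
      \<in> O[at_right 0](\<lambda>h. \<bar>?P h\<bar> + \<bar>?y h ^ (N + 1)\<bar>)"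
    by (rule bigoI)
  also note rhs
  also have "(\<lambda>h :: real. h ^ (N + 1)) = (\<lambda>h. h * h ^ N)"
    by simp
  finally have "(\<lambda>h. h * (4 * (radius_of_starlikeness (bessel_phi (1 / h)) * h / 4 - eps_trunc N h)))
      \<in> O[at_right 0](\<lambda>h. h * h ^ N)"
    by (simp only: mult_ac)
  moreover have "eventually (\<lambda>h. h \<noteq> 0) (at_right (0 :: real))"
    using eventually_at_right_less[of 0] by eventually_elim auto
  ultimately have "(\<lambda>h. 4 * (radius_of_starlikeness (bessel_phi (1 / h)) * h / 4 - eps_trunc N h))
      \<in> O[at_right 0](\<lambda>h. h ^ N)"
    by (subst (asm) landau_o.big.mult_cancel_left) auto
  then show ?thesis
    by (subst (asm) landau_o.big.cmult_in_iff) auto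
qed

lemma radius_expansion_at_top:
  assumes N: "N \<ge> 1"
  shows "(\<lambda>\<nu>::real. radius_of_starlikeness (bessel_phi \<nu>) / (4 * \<nu>)
             - (1 + (\<Sum>k=1..N-1. eps_coeff k / \<nu> ^ k))) \<in> O[at_top](\<lambda>\<nu>. 1 / \<nu> ^ N)"
proof -
  have "filterlim (\<lambda>\<nu>::real. 1 / \<nu>) (at_right 0) at_top"
    using filterlim_inverse_at_right_top by (simp add: inverse_eq_divide)
  from landau_o.big.compose[OF radius_expansion_at_zero[OF N] this]
  show ?thesis
    by (simp add: eps_trunc_def power_one_over mult.commute)
qed

section \<open>The first coefficients\<close>

lemma sum_atLeastAtMost_numeral:
  "sum f {m..numeral n} =
    (if m \<le> numeral n then sum f {m..pred_numeral n} + f (numeral n) else (0 :: 'a :: comm_monoid_add))"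
  by (simp add: numeral_eq_Suc)

text \<open>
  Multiplying by \<open>1 + k h\<close> instead of dividing removes one of the three summations, which keeps the
  evaluation of the values below short.
\<close>
lemma sigma_coeff_rec:
  assumes "k \<noteq> 1"
  shows "sigma_coeff k m = (if m = 0 then 0 else - real k * sigma_coeff k (m - 1)) +
    (\<Sum>n=1..k-1. \<Sum>j=0..m. sigma_coeff n j * sigma_coeff (k - n) (m - j))"
proof -
  have "sigma_fps k * (1 + fps_const (real k) * fps_X) = (\<Sum>n=1..k-1. sigma_fps n * sigma_fps (k - n))"
    by (subst sigma_fps_rec[OF assms]) (simp add: mult.assoc inverse_mult_eq_1)
  then have "fps_nth (sigma_fps k + fps_const (real k) * (fps_X * sigma_fps k)) m =
      fps_nth (\<Sum>n=1..k-1. sigma_fps n * sigma_fps (k - n)) m"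
    by (simp add: distrib_left mult_ac)
  then show ?thesis
    by (cases m) (simp_all add: fps_sum_nth fps_mult_nth[of "sigma_fps _"])
qed

text \<open>
  The coefficient \<open>\<epsilon>\<^sub>k\<close> involves \<open>sigma_coeff n m\<close> for \<open>n + m \<le> k + 1\<close>, so \<open>n + m \<le> 7\<close> suffices here.
\<close>
lemma sigma_coeff_2:
  "sigma_coeff 2 0 = 1 / 16"
  "sigma_coeff 2 (Suc 0) = - 1 / 4"
  "sigma_coeff 2 2 = 11 / 16"
  "sigma_coeff 2 3 = - 13 / 8"
  "sigma_coeff 2 4 = 57 / 16"
  "sigma_coeff 2 5 = - 15 / 2"
  by (simp_all add: sigma_coeff_rec[of 2] sum_atLeastAtMost_numeral sigma_coeff_1)

lemma sigma_coeff_3: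
  "sigma_coeff 3 0 = 1 / 32"
  "sigma_coeff 3 (Suc 0) = - 1 / 4"
  "sigma_coeff 3 2 = 5 / 4"
  "sigma_coeff 3 3 = - 81 / 16"
  "sigma_coeff 3 4 = 585 / 32"
  by (simp_all add: sigma_coeff_rec[of 3] sum_atLeastAtMost_numeral sigma_coeff_1 sigma_coeff_2)

lemma sigma_coeff_4:
  "sigma_coeff 4 0 = 5 / 256"
  "sigma_coeff 4 (Suc 0) = - 1 / 4"
  "sigma_coeff 4 2 = 245 / 128"
  "sigma_coeff 4 3 = - 23 / 2"
  by (simp_all add: sigma_coeff_rec[of 4] sum_atLeastAtMost_numeral sigma_coeff_1 sigma_coeff_2 sigma_coeff_3)

lemma sigma_coeff_5:
  "sigma_coeff 5 0 = 7 / 512"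
  "sigma_coeff 5 (Suc 0) = - 1 / 4"
  "sigma_coeff 5 2 = 1365 / 512"
  by (simp_all add: sigma_coeff_rec[of 5] sum_atLeastAtMost_numeral sigma_coeff_1 sigma_coeff_2 sigma_coeff_3 sigma_coeff_4)

lemma sigma_coeff_6:
  "sigma_coeff 6 0 = 21 / 2048"
  "sigma_coeff 6 (Suc 0) = - 1 / 4"
  by (simp_all add: sigma_coeff_rec[of 6] sum_atLeastAtMost_numeral sigma_coeff_1 sigma_coeff_2 sigma_coeff_3 sigma_coeff_4 sigma_coeff_5)

lemma sigma_coeff_7:
  "sigma_coeff 7 0 = 33 / 4096"
  by (simp_all add: sigma_coeff_rec[of 7] sum_atLeastAtMost_numeral sigma_coeff_1 sigma_coeff_2 sigma_coeff_3 sigma_coeff_4 sigma_coeff_5 sigma_coeff_6)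

lemmas sigma_coeff_values =
  sigma_coeff_1 sigma_coeff_2 sigma_coeff_3 sigma_coeff_4 sigma_coeff_5 sigma_coeff_6 sigma_coeff_7

lemma eps_coeff_rec:
  "eps_coeff k = (-1) ^ (k + 1) - (\<Sum>n=1..k-1. (-1) ^ (k - n) * eps_coeff n)
     - (\<Sum>n=2..k+1. 4 ^ n * (\<Sum>m=0..k+1-n. sigma_coeff n (k + 1 - n - m) * fps_nth (eps_fps ^ n) m))"
  by (subst eps_coeff.simps) (simp only: potential_poly_of_nat eps_fps_def)

lemma eps_fps_nth: "fps_nth eps_fps i = (if i = 0 then 1 else eps_coeff i)"
  by (simp add: eps_fps_def)

text \<open>
  As \<open>\<epsilon>\<^sub>1, \<dots>, \<epsilon>\<^sub>k\<^sub>-\<^sub>1\<close> become known, so do the coefficients of index below \<open>k\<close> of all powers of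
  \<open>1 + \<Sum>i. \<epsilon>\<^sub>i h\<^sup>i\<close>, uniformly in the exponent; the values \<open>\<epsilon>\<^sub>k\<close> and these coefficients are
  computed alternately.
\<close>
lemma eps_fps_power_nth_0: "fps_nth (eps_fps ^ n) 0 = 1"
  by (induction n) (simp_all add: eps_fps_nth)

lemma eps_fps_power_Suc_nth:
  "fps_nth (eps_fps ^ Suc n) m = (\<Sum>i=0..m. (if i = 0 then 1 else eps_coeff i) * fps_nth (eps_fps ^ n) (m - i))"
  by (simp add: fps_mult_nth eps_fps_nth)

lemma eps_coeff_1: "eps_coeff (Suc 0) = 0"
  by (subst eps_coeff_rec) (simp add: sum_atLeastAtMost_numeral sigma_coeff_values sigma_coeff_2(1)[unfolded numeral_2_eq_2] eps_fps_power_nth_0)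

lemma eps_fps_power_nth_1: "fps_nth (eps_fps ^ n) (Suc 0) = 0"
  by (induction n)
    (simp_all add: eps_fps_power_Suc_nth sum_atLeastAtMost_numeral eps_fps_power_nth_0 eps_coeff_1 field_simps del: power_Suc)

lemma eps_coeff_2: "eps_coeff 2 = 1"
  by (subst eps_coeff_rec) (simp add: sum_atLeastAtMost_numeral sigma_coeff_values eps_fps_power_nth_0 eps_coeff_1 eps_fps_power_nth_1)

lemma eps_fps_power_nth_2: "fps_nth (eps_fps ^ n) 2 = real n"
  by (induction n)
    (simp_all add: eps_fps_power_Suc_nth sum_atLeastAtMost_numeral eps_fps_power_nth_0 eps_coeff_1 eps_fps_power_nth_1 eps_coeff_2 field_simps del: power_Suc)

lemma eps_coeff_3: "eps_coeff 3 = 0"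
  by (subst eps_coeff_rec) (simp add: sum_atLeastAtMost_numeral sigma_coeff_values eps_fps_power_nth_0 eps_coeff_1 eps_fps_power_nth_1 eps_coeff_2 eps_fps_power_nth_2)

lemma eps_fps_power_nth_3: "fps_nth (eps_fps ^ n) 3 = 0"
  by (induction n)
    (simp_all add: eps_fps_power_Suc_nth sum_atLeastAtMost_numeral eps_fps_power_nth_0 eps_coeff_1 eps_fps_power_nth_1 eps_coeff_2 eps_fps_power_nth_2 eps_coeff_3 field_simps del: power_Suc)

lemma eps_coeff_4: "eps_coeff 4 = -4"
  by (subst eps_coeff_rec) (simp add: sum_atLeastAtMost_numeral sigma_coeff_values eps_fps_power_nth_0 eps_coeff_1 eps_fps_power_nth_1 eps_coeff_2 eps_fps_power_nth_2 eps_coeff_3 eps_fps_power_nth_3)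

lemma eps_fps_power_nth_4: "fps_nth (eps_fps ^ n) 4 = real n * (real n - 1) / 2 - 4 * real n"
  by (induction n)
    (simp_all add: eps_fps_power_Suc_nth sum_atLeastAtMost_numeral eps_fps_power_nth_0 eps_coeff_1 eps_fps_power_nth_1 eps_coeff_2 eps_fps_power_nth_2 eps_coeff_3 eps_fps_power_nth_3 eps_coeff_4 field_simps del: power_Suc)

lemma eps_coeff_5: "eps_coeff 5 = 2"
  by (subst eps_coeff_rec) (simp add: sum_atLeastAtMost_numeral sigma_coeff_values eps_fps_power_nth_0 eps_coeff_1 eps_fps_power_nth_1 eps_coeff_2 eps_fps_power_nth_2 eps_coeff_3 eps_fps_power_nth_3 eps_coeff_4 eps_fps_power_nth_4)

lemma eps_fps_power_nth_5: "fps_nth (eps_fps ^ n) 5 = 2 * real n"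
  by (induction n)
    (simp_all add: eps_fps_power_Suc_nth sum_atLeastAtMost_numeral eps_fps_power_nth_0 eps_coeff_1 eps_fps_power_nth_1 eps_coeff_2 eps_fps_power_nth_2 eps_coeff_3 eps_fps_power_nth_3 eps_coeff_4 eps_fps_power_nth_4 eps_coeff_5 field_simps del: power_Suc)

lemma eps_coeff_6: "eps_coeff 6 = 44"
  by (subst eps_coeff_rec) (simp add: sum_atLeastAtMost_numeral sigma_coeff_values eps_fps_power_nth_0 eps_coeff_1 eps_fps_power_nth_1 eps_coeff_2 eps_fps_power_nth_2 eps_coeff_3 eps_fps_power_nth_3 eps_coeff_4 eps_fps_power_nth_4 eps_coeff_5 eps_fps_power_nth_5)

theorem theorem1:
  shows "(\<forall>N\<ge>1. (\<lambda>\<nu>::real. radius_of_starlikeness (bessel_phi \<nu>) / (4 * \<nu>)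
             - (1 + (\<Sum>k=1..N-1. eps_coeff k / \<nu> ^ k))) \<in> O[at_top](\<lambda>\<nu>. 1 / \<nu> ^ N))
       \<and> eps_coeff 1 = 0 \<and> eps_coeff 2 = 1 \<and> eps_coeff 3 = 0
       \<and> eps_coeff 4 = -4 \<and> eps_coeff 5 = 2 \<and> eps_coeff 6 = 44"
  using radius_expansion_at_top eps_coeff_1 eps_coeff_2 eps_coeff_3 eps_coeff_4 eps_coeff_5 eps_coeff_6
  by simp

end
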